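(* Let $k<t$ be positive integers such that $k$ is even, $t \geq 923$ is odd and $k,t$ are coprime (so that the distance graph $D(k,t)$ is connected). Then $\chi_{\rho}(D(k,t)) \leq 56$.
   Context: For positive integers $k<t$, the distance graph $D(k,t)$ is the infinite simple undirected graph with vertex set $\mathbb{Z}$ in which two distinct integers $i,j$ are adjacent if and only if $|i-j|\in\{k,t\}$. For a connected graph $G$, $\mathrm{dist}_G(u,v)$ denotes the graph distance. For a positive integer $i$, an $i$-packing is a set $X_i$ of vertices such that any two distinct $u,v\in X_i$ satisfy $\mathrm{dist}_G(u,v)>i$. A packing $p$-coloring of $G$ is a partition of $V(G)$ into disjoint (possibly empty) classes $X_1,\dots,X_p$ such that each $X_i$ is an $i$-packing. The packing chromatic number $\chi_\rho(G)$ is the smallest integer $p$ for which $G$ has a packing $p$-coloring. *)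

theory Defs
  imports Main "HOL-Library.Extended_Nat" "HOL-Library.Disjoint_Sets"
begin

text \<open>
  An undirected simple graph is given by its vertex set and its adjacency relation, which is
  meant to be a symmetric and irreflexive relation on the vertices.
\<close>

record 'a graph =
  verts :: "'a set"
  adj :: "('a \<times> 'a) set"

definition simple_graph :: "'a graph \<Rightarrow> bool" where
  "simple_graph G \<longleftrightarrow> adj G \<subseteq> verts G \<times> verts G \<and> sym (adj G) \<and> irrefl (adj G)"

definition distance_graph :: "nat \<Rightarrow> nat \<Rightarrow> int graph" where
  "distance_graph k t =
     \<lparr> verts = UNIV, adj = {(i, j). i \<noteq> j \<and> \<bar>i - j\<bar> \<in> {int k, int t}} \<rparr>"

lemma simple_graph_distance_graph: "simple_graph (distance_graph k t)"
  by (auto simp: simple_graph_def distance_graph_def sym_def irrefl_def abs_minus_commute)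

text \<open>
  The pair \<open>(u, v)\<close> lies in \<open>adj G ^^ n\<close> iff there is a walk of length \<open>n\<close> from \<open>u\<close> to \<open>v\<close>.
  The distance is \<open>\<infinity>\<close> if there is no walk, since the infimum of the empty set is \<open>\<infinity>\<close>.
\<close>

definition graph_dist :: "'a graph \<Rightarrow> 'a \<Rightarrow> 'a \<Rightarrow> enat" where
  "graph_dist G u v = Inf {enat n | n. (u, v) \<in> adj G ^^ n}"

definition packing :: "'a graph \<Rightarrow> nat \<Rightarrow> 'a set \<Rightarrow> bool" where
  "packing G i S \<longleftrightarrow>
     S \<subseteq> verts G \<and> (\<forall>u\<in>S. \<forall>v\<in>S. u \<noteq> v \<longrightarrow> graph_dist G u v > enat i)"

text \<open>Classes are indexed by \<open>1, \<dots>, p\<close> and may be empty; values of \<open>X\<close> elsewhere are irrelevant.\<close>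

definition packing_coloring :: "'a graph \<Rightarrow> nat \<Rightarrow> (nat \<Rightarrow> 'a set) \<Rightarrow> bool" where
  "packing_coloring G p X \<longleftrightarrow>
     (\<Union>i\<in>{1..p}. X i) = verts G \<and> disjoint_family_on X {1..p} \<and> (\<forall>i\<in>{1..p}. packing G i (X i))"

text \<open>The value is \<open>\<infinity>\<close> if \<open>G\<close> has no packing coloring with finitely many classes.\<close>

definition packing_chromatic_number :: "'a graph \<Rightarrow> enat" where
  "packing_chromatic_number G = Inf {enat p | p. \<exists>X. packing_coloring G p X}"

end

theory Submission
  imports Defs
begin

text \<open>
  Since \<open>k\<close> and \<open>t\<close> are coprime, \<open>(x, y) \<mapsto> x k + y t\<close> maps the square grid onto the integers, and
  two points have the same image iff they differ by a multiple of \<open>(t, - k)\<close>. Hence \<open>D(k, t)\<close> is the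
  grid rolled up along this translation: a cylinder of circumference \<open>t\<close> whose ends are glued with
  a twist of \<open>k\<close>. A packing coloring of \<open>D(k, t)\<close> is therefore the same as a coloring of the grid
  that is invariant under \<open>(t, - k)\<close> and in which two distinct points of color \<open>c\<close> with different
  images have \<open>\<ell>\<^sub>1\<close>-distance more than \<open>c\<close> (\<open>packing_chromatic_number_le_of_grid_coloring\<close>).

  The grid itself has a packing coloring with 17 colors that has period 24 in both directions
  (\<open>grid_color\<close>), but the translation \<open>(t, - k)\<close> respects it only if 24 divides both \<open>t\<close> and \<open>k\<close>.
  The remedy is to insert additional columns, called seams, into the coloring. A seam moves its two
  sides apart by one step, so the right side may in addition slip up or down by one step: every
  path across the seam has a horizontal step to spare, which pays for the slip, and no distance
  drops below its value in the original coloring (\<open>steps_contract\<close>). If the number of seams is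
  congruent to \<open>t\<close> modulo 24 and the sum of the slips is congruent to \<open>k\<close>, the coloring closes up.

  The seams are colored with 1 and the colors from 18 on. The original coloring uses 1 exactly on
  one class of a checkerboard. A seam with slip \<open>\<plusminus>1\<close> continues the checkerboard, so that only half of
  its points need a large color; such half seams can be as close as 25 steps when they use the
  colors 18 to 47. For odd \<open>t\<close> and even \<open>k\<close> the number of seams is odd while the number of slips is
  even, so at least one seam does not slip. Across it the checkerboard changes its parity, and color
  1 is useless on it; this full seam is colored with 18 to 55, and stays 49 steps away from
  the half seams because 18 to 47 occur on both kinds.

  At most 34 half seams are ever needed. They fit onto the cylinder together with the full seam
  as soon as \<open>t \<ge> 49 + 33 \<cdot> 25 + 49 = 923\<close>.
\<close>

section \<open>Coloring the grid instead of the distance graph\<close>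

lemma walk_in_distance_graph:
  assumes "(u, v) \<in> adj (distance_graph k t) ^^ n"
  shows "\<exists>a b. v - u = a * int k + b * int t \<and> \<bar>a\<bar> + \<bar>b\<bar> \<le> int n"
  using assms
proof (induction n arbitrary: v)
  case 0
  then show ?case by (intro exI[of _ 0]) simp
next
  case (Suc n)
  then obtain w where w: "(u, w) \<in> adj (distance_graph k t) ^^ n"
    and wv: "(w, v) \<in> adj (distance_graph k t)"
    by auto
  from Suc.IH[OF w] obtain a b where ab: "w - u = a * int k + b * int t" "\<bar>a\<bar> + \<bar>b\<bar> \<le> int n"
    by blast
  from wv have "v - w = int k \<or> v - w = - int k \<or> v - w = int t \<or> v - w = - int t"
    unfolding distance_graph_def by (auto simp: abs_if split: if_splits)
  then consider "v - w = int k" | "v - w = - int k" | "v - w = int t" | "v - w = - int t"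
    by blast
  then show ?case
  proof cases
    case 1
    then show ?thesis using ab by (intro exI[of _ "a + 1"] exI[of _ b]) (auto simp: algebra_simps)
  next
    case 2
    then show ?thesis using ab by (intro exI[of _ "a - 1"] exI[of _ b]) (auto simp: algebra_simps)
  next
    case 3
    then show ?thesis using ab by (intro exI[of _ a] exI[of _ "b + 1"]) (auto simp: algebra_simps)
  next
    case 4
    then show ?thesis using ab by (intro exI[of _ a] exI[of _ "b - 1"]) (auto simp: algebra_simps)
  qed
qed

lemma periodic_shift_multiple:
  fixes C :: "int \<Rightarrow> int \<Rightarrow> 'a"
  assumes "\<And>x y. C (x + a) (y - b) = C x y"
  shows "C (x + j * a) (y - j * b) = C x y"
proof (induction j rule: int_induct[where k = 0])
  case base
  then show ?case by simp
next
  case (step1 i)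
  then show ?case using assms[of "x + i * a" "y - i * b"] by (simp add: algebra_simps)
next
  case (step2 i)
  then show ?case using assms[of "x + (i - 1) * a" "y - (i - 1) * b"] by (simp add: algebra_simps)
qed

text \<open>
  A walk of length \<open>n\<close> in \<open>D(k, t)\<close> lifts to a displacement of \<open>\<ell>\<^sub>1\<close>-norm at most \<open>n\<close> in the grid, so a
  conflict between two integers would lift to a conflict between two grid points. Periodicity is
  what makes the color of an integer independent of the chosen preimage.
\<close>

lemma packing_chromatic_number_le_of_grid_coloring:
  fixes C :: "int \<Rightarrow> int \<Rightarrow> int"
  assumes cop: "coprime k t" and "0 < t"
    and periodic: "\<And>x y. C (x + int t) (y - int k) = C x y"
    and range: "\<And>x y. 1 \<le> C x y \<and> C x y \<le> int p"
    and sep: "\<And>x y x' y'. C x y = C x' y' \<Longrightarrow> \<bar>x' - x\<bar> + \<bar>y' - y\<bar> \<le> C x y \<Longrightarrow> x' = x \<and> y' = y"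
  shows "packing_chromatic_number (distance_graph k t) \<le> enat p"
proof -
  have "\<exists>x y. n = x * int k + y * int t" for n :: int
  proof -
    from cop have "gcd (int k) (int t) = 1" by simp
    then obtain a b where "a * int k + b * int t = 1"
      using bezout_int[of "int k" "int t"] by auto
    then have "n = (n * a) * int k + (n * b) * int t"
      by (metis distrib_left mult.assoc mult.right_neutral)
    then show ?thesis by blast
  qed
  then obtain X Y where XY: "\<And>n. n = X n * int k + Y n * int t" by metis
  define col where "col n = C (X n) (Y n)" for n
  have col: "col (x * int k + y * int t) = C x y" for x y
  proof -
    define n where "n = x * int k + y * int t"
    \<comment> \<open>By coprimality, two preimages of \<open>n\<close> differ by a multiple of \<open>(t, - k)\<close>.\<close>
    have eq: "(X n - x) * int k = (y - Y n) * int t"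
      using XY[of n] unfolding n_def[symmetric] using n_def by (simp add: algebra_simps)
    then have "int t dvd (X n - x) * int k" by simp
    then have "int t dvd X n - x"
      using cop by (metis coprime_commute coprime_dvd_mult_left_iff coprime_int_iff)
    then obtain j where j: "X n - x = j * int t" by (metis dvd_def mult.commute)
    with eq have "y - Y n = j * int k"
      using \<open>0 < t\<close> by (simp add: mult.assoc mult.commute[of "int t"] flip: mult.assoc)
    with j have "X n = x + j * int t" "Y n = y - j * int k" by auto
    then show ?thesis
      using periodic_shift_multiple[of C "int t" "int k" x j y] periodic
      unfolding col_def n_def[symmetric] by simp
  qed
  define cls where "cls i = {n. col n = int i}" for i
  have "packing (distance_graph k t) i (cls i)" for i
    unfolding packing_def
  proof (intro conjI ballI impI)
    show "cls i \<subseteq> verts (distance_graph k t)" by (simp add: distance_graph_def)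
    fix u v assume u: "u \<in> cls i" and v: "v \<in> cls i" and "u \<noteq> v"
    have far: "i < n" if walk: "(u, v) \<in> adj (distance_graph k t) ^^ n" for n
    proof (rule ccontr)
      assume "\<not> i < n"
      obtain a b where ab: "v - u = a * int k + b * int t" "\<bar>a\<bar> + \<bar>b\<bar> \<le> int n"
        using walk_in_distance_graph[OF walk] by blast
      have v_eq: "v = (X u + a) * int k + (Y u + b) * int t"
        using ab(1) XY[of u] by (simp add: algebra_simps)
      have "C (X u) (Y u) = int i" using u by (simp add: cls_def col_def)
      moreover have "C (X u + a) (Y u + b) = int i"
        using v col[of "X u + a" "Y u + b"] unfolding v_eq[symmetric] by (simp add: cls_def)
      ultimately have "X u + a = X u \<and> Y u + b = Y u"
        using ab(2) \<open>\<not> i < n\<close> by (intro sep) auto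
      then show False using ab(1) \<open>u \<noteq> v\<close> by simp
    qed
    have "enat (Suc i) \<le> graph_dist (distance_graph k t) u v"
      unfolding graph_dist_def
    proof (rule Inf_greatest)
      fix e assume "e \<in> {enat n |n. (u, v) \<in> adj (distance_graph k t) ^^ n}"
      then show "enat (Suc i) \<le> e" using far by (auto simp: Suc_le_eq)
    qed
    then show "enat i < graph_dist (distance_graph k t) u v"
      by (meson enat_ord_simps(2) lessI less_le_trans)
  qed
  moreover have "(\<Union>i\<in>{1..p}. cls i) = verts (distance_graph k t)"
  proof -
    have "n \<in> (\<Union>i\<in>{1..p}. cls i)" for n
    proof
      show "nat (col n) \<in> {1..p}" using range[of "X n" "Y n"] by (auto simp: col_def)
      show "n \<in> cls (nat (col n))" using range[of "X n" "Y n"] by (auto simp: cls_def col_def)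
    qed
    then show ?thesis by (auto simp: distance_graph_def)
  qed
  moreover have "disjoint_family_on cls {1..p}"
    by (auto simp: disjoint_family_on_def cls_def)
  ultimately have "packing_coloring (distance_graph k t) p cls"
    by (simp add: packing_coloring_def)
  then show ?thesis
    unfolding packing_chromatic_number_def by (intro Inf_lower) blast
qed


section \<open>A packing coloring of the square grid\<close>

text \<open>
  One period of the coloring, with rows indexed by the second coordinate; it was found by a computer
  search. Color 1 takes one class of the checkerboard. Colors 2 and 3 repeat with period 12 and
  fill half of the rest; the other half was filled by a local search over the colors 4 to 17.
\<close>

definition tile :: "int list list" where
  "tile =
   [[ 5, 1, 3, 1, 2, 1, 3, 1,12, 1, 6, 1, 7, 1, 3, 1, 2, 1, 3, 1, 4, 1, 8, 1],
    [ 1, 6, 1, 4, 1,13, 1, 2, 1, 3, 1, 2, 1, 5, 1, 4, 1,10, 1, 2, 1, 3, 1, 2],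
    [ 3, 1, 2, 1, 3, 1,11, 1, 5, 1, 4, 1, 3, 1, 2, 1, 3, 1, 7, 1, 5, 1,14, 1],
    [ 1, 7, 1, 5, 1, 2, 1, 3, 1, 2, 1, 9, 1, 8, 1, 6, 1, 2, 1, 3, 1, 2, 1, 4],
    [ 2, 1, 3, 1, 8, 1, 4, 1, 7, 1, 3, 1, 2, 1, 3, 1, 5, 1, 4, 1,11, 1, 3, 1],
    [ 1, 9, 1, 2, 1, 3, 1, 2, 1,10, 1, 5, 1, 4, 1, 2, 1, 3, 1, 2, 1, 6, 1, 5],
    [ 3, 1, 4, 1, 6, 1, 5, 1, 3, 1, 2, 1, 3, 1, 7, 1,13, 1,12, 1, 3, 1, 2, 1],
    [ 1, 2, 1, 3, 1, 2, 1,15, 1, 4, 1, 6, 1, 2, 1, 3, 1, 2, 1, 5, 1, 4, 1,10],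
    [16, 1, 5, 1, 7, 1, 3, 1, 2, 1, 3, 1,11, 1, 5, 1, 4, 1, 3, 1, 2, 1, 3, 1],
    [ 1, 3, 1, 2, 1, 4, 1, 9, 1, 5, 1, 2, 1, 3, 1, 2, 1, 6, 1, 7, 1, 8, 1, 2],
    [ 4, 1,11, 1, 3, 1, 2, 1, 3, 1, 7, 1, 4, 1,17, 1, 3, 1, 2, 1, 3, 1, 5, 1],
    [ 1, 2, 1,12, 1, 5, 1, 6, 1, 2, 1, 3, 1, 2, 1,10, 1, 5, 1, 4, 1, 2, 1, 3],
    [ 7, 1, 3, 1, 2, 1, 3, 1, 4, 1, 8, 1, 5, 1, 3, 1, 2, 1, 3, 1, 9, 1, 6, 1],
    [ 1, 5, 1, 4, 1,10, 1, 2, 1, 3, 1, 2, 1, 6, 1, 7, 1,14, 1, 2, 1, 3, 1, 2],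
    [ 3, 1, 2, 1, 3, 1, 7, 1, 5, 1,13, 1, 3, 1, 2, 1, 3, 1,11, 1, 5, 1, 4, 1],
    [ 1, 8, 1, 6, 1, 2, 1, 3, 1, 2, 1, 4, 1,12, 1, 5, 1, 2, 1, 3, 1, 2, 1,15],
    [ 2, 1, 3, 1, 5, 1, 4, 1,11, 1, 3, 1, 2, 1, 3, 1, 8, 1, 4, 1, 7, 1, 3, 1],
    [ 1, 4, 1, 2, 1, 3, 1, 2, 1, 6, 1, 7, 1, 9, 1, 2, 1, 3, 1, 2, 1,10, 1, 5],
    [ 3, 1, 7, 1, 9, 1,14, 1, 3, 1, 2, 1, 3, 1, 4, 1, 6, 1, 5, 1, 3, 1, 2, 1],
    [ 1, 2, 1, 3, 1, 2, 1, 5, 1, 4, 1,10, 1, 2, 1, 3, 1, 2, 1,13, 1, 4, 1, 6],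
    [11, 1, 5, 1, 4, 1, 3, 1, 2, 1, 3, 1,15, 1, 5, 1, 7, 1, 3, 1, 2, 1, 3, 1],
    [ 1, 3, 1, 2, 1, 6, 1, 7, 1, 8, 1, 2, 1, 3, 1, 2, 1, 4, 1, 9, 1, 5, 1, 2],
    [ 4, 1,17, 1, 3, 1, 2, 1, 3, 1, 5, 1, 4, 1,11, 1, 3, 1, 2, 1, 3, 1, 7, 1],
    [ 1, 2, 1,10, 1, 5, 1, 4, 1, 2, 1, 3, 1, 2, 1,16, 1, 5, 1, 6, 1, 2, 1, 3]]"

definition grid_color :: "int \<Rightarrow> int \<Rightarrow> int" where
  "grid_color u v = tile ! nat (v mod 24) ! nat (u mod 24)"

definition tile_entries :: "(int \<times> int \<times> int) list" where
  "tile_entries = concat (map (\<lambda>(v, row). map (\<lambda>(u, c). (c, u, v)) (zip [0..23] row)) (zip [0..23] tile))"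

definition tile_class :: "int \<Rightarrow> (int \<times> int) list" where
  "tile_class c = map snd (filter (\<lambda>e. fst e = c) tile_entries)"

definition cyclic_dist :: "int \<Rightarrow> int \<Rightarrow> int" where
  "cyclic_dist a b = min \<bar>a - b\<bar> (24 - \<bar>a - b\<bar>)"

definition apart :: "int \<Rightarrow> int \<times> int \<Rightarrow> int \<times> int \<Rightarrow> bool" where
  "apart c P Q \<longleftrightarrow> c < cyclic_dist (fst P) (fst Q) + cyclic_dist (snd P) (snd Q)"

lemma tile_entry:
  "(grid_color u v, u mod 24, v mod 24) \<in> set tile_entries"
proof -
  define i j where "i = nat (u mod 24)" and "j = nat (v mod 24)"
  have ij: "i < 24" "j < 24" "int i = u mod 24" "int j = v mod 24"
    by (simp_all add: i_def j_def nat_less_iff)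
  have upto: "[0..23] ! n = int n" "length [0..23::int] = 24" if "n < 24" for n
    using that by simp_all
  have tile_length: "length tile = 24" and "\<forall>row\<in>set tile. length row = 24"
    by (simp_all add: tile_def)
  then have row: "length (tile ! j) = 24"
    using ij by simp
  have "(int j, tile ! j) \<in> set (zip [0..23] tile)"
    using ij tile_length upto by (auto simp: set_zip intro!: exI[of _ j])
  moreover have "(int i, tile ! j ! i) \<in> set (zip [0..23] (tile ! j))"
    using ij row upto by (auto simp: set_zip intro!: exI[of _ i])
  ultimately show ?thesis
    unfolding tile_entries_def grid_color_def i_def[symmetric] j_def[symmetric] ij(3,4)[symmetric]
    by (force intro!: bexI[of _ "(int j, tile ! j)"])
qed

lemma tile_colors:
  "list_all (\<lambda>(c, u, v). 1 \<le> c \<and> c \<le> 17 \<and> (c = 1 \<longleftrightarrow> odd (u + v))) tile_entries"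
  by code_simp

text \<open>
  The finite computation behind the coloring. Comparing positions only within one color class, and
  every pair only once, keeps it small enough for the simplifier.
\<close>

lemma tile_classes_apart:
  "list_all (\<lambda>c. sorted_wrt (apart c) (tile_class c)) [2..17]"
  by code_simp

lemma grid_color_range: "1 \<le> grid_color u v" "grid_color u v \<le> 17"
  using tile_colors tile_entry[of u v] by (auto simp: list_all_iff)

lemma grid_color_eq_1_iff: "grid_color u v = 1 \<longleftrightarrow> odd (u + v)"
proof -
  have "grid_color u v = 1 \<longleftrightarrow> odd (u mod 24 + v mod 24)"
    using tile_colors tile_entry[of u v] by (auto simp: list_all_iff)
  also have "\<dots> \<longleftrightarrow> odd (u + v)"
    by presburger
  finally show ?thesis .
qed

lemma cyclic_dist_le: "cyclic_dist (a mod 24) (b mod 24) \<le> \<bar>a - b\<bar>"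
proof -
  define q d where "q = a div 24 - b div 24" and "d = a mod 24 - b mod 24"
  have diff: "a - b = d + 24 * q"
    unfolding q_def d_def by (simp add: algebra_simps)
  have dist: "cyclic_dist (a mod 24) (b mod 24) = min \<bar>d\<bar> (24 - \<bar>d\<bar>)"
    by (simp add: cyclic_dist_def d_def)
  consider "q = 0" | "1 \<le> \<bar>q\<bar>" by linarith
  then show ?thesis
  proof cases
    case 1
    then show ?thesis using diff dist by simp
  next
    case 2
    then have "24 - \<bar>d\<bar> \<le> \<bar>a - b\<bar>" using diff by linarith
    then show ?thesis using dist by linarith
  qed
qed

lemma cyclic_dist_commute: "cyclic_dist a b = cyclic_dist b a"
  by (simp add: cyclic_dist_def abs_minus_commute)

lemma eq_of_mod_eq:
  fixes a b m :: int
  assumes "a mod m = b mod m" and "\<bar>a - b\<bar> < m"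
  shows "a = b"
proof -
  have "m dvd a - b" using assms(1) by (simp add: mod_eq_dvd_iff)
  then show ?thesis using assms(2) zdvd_not_zless[of "\<bar>a - b\<bar>" m] by auto
qed

text \<open>
  A residue modulo \<open>2 n\<close> amounts to a residue modulo \<open>n\<close> and the choice of one of two halves; the
  color patterns on the seams are read off in this form.
\<close>

lemma eq_mod_double:
  fixes n m m' :: int
  assumes "0 < n" and eq: "m mod n = m' mod n" and half: "m mod (2 * n) < n \<longleftrightarrow> m' mod (2 * n) < n"
  shows "m mod (2 * n) = m' mod (2 * n)"
proof -
  define r r' where "r = m mod (2 * n)" and "r' = m' mod (2 * n)"
  have "0 \<le> r" "r < 2 * n" "0 \<le> r'" "r' < 2 * n"
    using assms(1) by (simp_all add: r_def r'_def)
  then have "\<bar>r - r'\<bar> < n"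
    using half unfolding r_def[symmetric] r'_def[symmetric] by linarith
  moreover have "r mod n = r' mod n"
    using eq by (simp add: r_def r'_def mod_mod_cancel)
  ultimately show ?thesis
    unfolding r_def[symmetric] r'_def[symmetric] using eq_of_mod_eq by blast
qed

lemma grid_color_separated:
  assumes eq: "grid_color u v = grid_color u' v'" and "1 < grid_color u v"
    and near: "\<bar>u' - u\<bar> + \<bar>v' - v\<bar> \<le> grid_color u v"
  shows "u' = u \<and> v' = v"
proof -
  define c P Q where "c = grid_color u v" and "P = (u mod 24, v mod 24)" and "Q = (u' mod 24, v' mod 24)"
  have c: "c \<in> set [2..17]"
    unfolding set_upto using assms(2) grid_color_range[of u v] by (simp add: c_def)
  have PQ: "P \<in> set (tile_class c)" "Q \<in> set (tile_class c)"
    using tile_entry[of u v] tile_entry[of u' v'] eq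
    by (force simp: tile_class_def c_def P_def Q_def)+
  have not_apart: "\<not> apart c P Q" "\<not> apart c Q P"
    using cyclic_dist_le[of u u'] cyclic_dist_le[of v v'] near
    by (auto simp: apart_def c_def P_def Q_def cyclic_dist_commute abs_minus_commute)
  have "P = Q"
  proof -
    have sorted: "sorted_wrt (apart c) (tile_class c)"
      using tile_classes_apart c unfolding list_all_iff by blast
    obtain i j where "i < length (tile_class c)" "tile_class c ! i = P"
      and "j < length (tile_class c)" "tile_class c ! j = Q"
      using PQ by (metis in_set_conv_nth)
    with sorted not_apart show ?thesis
      by (metis linorder_neqE_nat sorted_wrt_iff_nth_less)
  qed
  then have "u' mod 24 = u mod 24" "v' mod 24 = v mod 24"
    by (simp_all add: P_def Q_def)
  moreover have "\<bar>u' - u\<bar> < 24" "\<bar>v' - v\<bar> < 24"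
    using near grid_color_range(2)[of u v] by linarith+
  ultimately show ?thesis
    using eq_of_mod_eq by metis
qed

lemma grid_color_mod:
  assumes "u mod 24 = u' mod 24" and "v mod 24 = v' mod 24"
  shows "grid_color u v = grid_color u' v'"
  using assms by (simp add: grid_color_def)


section \<open>Colors for the seams\<close>

text \<open>
  The color of the \<open>m\<close>-th point among those points of half seam number \<open>j\<close> that do not have color 1.
  Successive values of \<open>m\<close> belong to points two steps apart, so the colors 18 to 23, of period 12 in
  \<open>m\<close>, recur at distance 24, and the others recur at distance 48. Of these others, seams with even
  number use 24 to 35 and seams with odd number 36 to 47. Thus neighboring seams, 25 steps apart,
  share only colors below 24, and two seams that share more are at least 50 steps apart.
\<close>

definition half_seam_color :: "int \<Rightarrow> int \<Rightarrow> int" where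
  "half_seam_color j m = (let r = m mod 24; base = (if even j then 24 else 36) in
     if r < 6 then 18 + r
     else if r < 12 then base + (r - 6)
     else if r < 18 then 18 + (r - 12)
     else base + (r - 12))"

lemma half_seam_color_range: "18 \<le> half_seam_color j m" "half_seam_color j m \<le> 47"
proof -
  define r where "r = m mod 24"
  have "0 \<le> r" "r < 24" by (simp_all add: r_def)
  then show "18 \<le> half_seam_color j m" "half_seam_color j m \<le> 47"
    by (simp_all add: half_seam_color_def r_def[symmetric])
qed

lemma half_seam_color_separated:
  assumes eq: "half_seam_color j m = half_seam_color j m'"
    and near: "2 * \<bar>m - m'\<bar> \<le> half_seam_color j m"
  shows "m = m'"
proof -
  define r r' where "r = m mod 24" and "r' = m' mod 24"
  have r: "0 \<le> r" "r < 24" "0 \<le> r'" "r' < 24" by (simp_all add: r_def r'_def)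
  note color = half_seam_color_def[of j m, unfolded Let_def, folded r_def]
    half_seam_color_def[of j m', unfolded Let_def, folded eq r'_def]
  show ?thesis
  proof (cases "half_seam_color j m < 24")
    case True
    have "r = r' \<or> r = r' + 12 \<or> r' = r + 12"
      using True color r by (simp split: if_splits)
    then have "r mod 12 = r' mod 12" by auto
    then have "m mod 12 = m' mod 12" by (simp add: r_def r'_def mod_mod_cancel)
    then show ?thesis using near True by (intro eq_of_mod_eq[of m 12]) auto
  next
    case False
    have "r = r'"
      using False color r by (simp split: if_splits)
    then show ?thesis
      using near half_seam_color_range(2)[of j m]
      by (intro eq_of_mod_eq[of m 24]) (auto simp: r_def r'_def)
  qed
qed

lemma half_seam_colors_common:
  assumes eq: "half_seam_color j m = half_seam_color j' m'" and "even j \<noteq> even j'"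
  shows "half_seam_color j m < 24"
proof -
  define r r' where "r = m mod 24" and "r' = m' mod 24"
  have r: "0 \<le> r" "r < 24" "0 \<le> r'" "r' < 24" by (simp_all add: r_def r'_def)
  note color = half_seam_color_def[of j m, unfolded Let_def, folded r_def]
    half_seam_color_def[of j' m', unfolded Let_def, folded eq r'_def]
  show ?thesis
    using assms(2) color r by (simp split: if_splits)
qed

text \<open>
  Every color \<open>c\<close> from 18 to 55 occupies a single residue class whose modulus exceeds \<open>c\<close>, so the
  formula encodes an exact cover of the integers by 38 residue classes. Each of the six residue
  classes modulo 6 is split further: into 4, into 2 and 4 (of half the density), into 5, into 6,
  into 7, and into 8 and 2 (of half the density). The moduli are 24, 24 and 48, 30, 36, 42, 54 and 108.
\<close>

definition full_seam_color :: "int \<Rightarrow> int" where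
  "full_seam_color y = (let q = y div 6; r = y mod 6 in
     if r = 0 then 18 + q mod 4
     else if r = 1 then (if q mod 4 < 2 then 22 + q mod 4 else 40 + q mod 4 + (if q mod 8 < 4 then 0 else 2))
     else if r = 2 then 24 + q mod 5
     else if r = 3 then 30 + q mod 6
     else if r = 4 then (if q mod 7 = 6 then 29 else 36 + q mod 7)
     else (if q mod 9 < 8 then 46 + q mod 9 else if q mod 18 < 9 then 54 else 55))"

lemma full_seam_color_simps:
  "full_seam_color (6 * q) = 18 + q mod 4"
  "full_seam_color (6 * q + 1) =
     (if q mod 4 < 2 then 22 + q mod 4 else 40 + q mod 4 + (if q mod 8 < 4 then 0 else 2))"
  "full_seam_color (6 * q + 2) = 24 + q mod 5"
  "full_seam_color (6 * q + 3) = 30 + q mod 6"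
  "full_seam_color (6 * q + 4) = (if q mod 7 = 6 then 29 else 36 + q mod 7)"
  "full_seam_color (6 * q + 5) =
     (if q mod 9 < 8 then 46 + q mod 9 else if q mod 18 < 9 then 54 else 55)"
  by (simp_all add: full_seam_color_def)

text \<open>
  The six residue classes modulo 6 use disjoint sets of colors, so equal colors force equal residues.
\<close>

lemma full_seam_color_block:
  "(y mod 6 = 0 \<and> 18 \<le> full_seam_color y \<and> full_seam_color y \<le> 21) \<or>
   (y mod 6 = 1 \<and> 22 \<le> full_seam_color y \<and> full_seam_color y \<le> 23) \<or>
   (y mod 6 = 1 \<and> 42 \<le> full_seam_color y \<and> full_seam_color y \<le> 45) \<or>
   (y mod 6 = 2 \<and> 24 \<le> full_seam_color y \<and> full_seam_color y \<le> 28) \<or>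
   (y mod 6 = 3 \<and> 30 \<le> full_seam_color y \<and> full_seam_color y \<le> 35) \<or>
   (y mod 6 = 4 \<and> full_seam_color y = 29) \<or>
   (y mod 6 = 4 \<and> 36 \<le> full_seam_color y \<and> full_seam_color y \<le> 41) \<or>
   (y mod 6 = 5 \<and> 46 \<le> full_seam_color y \<and> full_seam_color y \<le> 55)"
proof -
  define q where "q = y div 6"
  have "y = 6 * q + y mod 6" "0 \<le> y mod 6" "y mod 6 < 6" by (simp_all add: q_def)
  then consider "y = 6 * q" | "y = 6 * q + 1" | "y = 6 * q + 2" | "y = 6 * q + 3"
    | "y = 6 * q + 4" | "y = 6 * q + 5"
    by linarith
  then show ?thesis
  proof cases
    case 1
    define a where "a = q mod 4"
    have "full_seam_color y = 18 + a"
      unfolding 1 full_seam_color_simps a_def ..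
    moreover have "0 \<le> a" "a < 4" by (simp_all add: a_def)
    ultimately have "18 \<le> full_seam_color y \<and> full_seam_color y \<le> 21"
      by simp
    moreover have "y mod 6 = 0" using 1 by simp
    ultimately show ?thesis by blast
  next
    case 2
    define a where "a = q mod 4"
    have "full_seam_color y = (if a < 2 then 22 + a else 40 + a + (if q mod 8 < 4 then 0 else 2))"
      unfolding 2 full_seam_color_simps a_def ..
    moreover have "0 \<le> a" "a < 4" by (simp_all add: a_def)
    ultimately have "22 \<le> full_seam_color y \<and> full_seam_color y \<le> 23 \<or>
        42 \<le> full_seam_color y \<and> full_seam_color y \<le> 45"
      by auto
    moreover have "y mod 6 = 1" using 2 by simp
    ultimately show ?thesis by blast
  next
    case 3
    define a where "a = q mod 5"
    have "full_seam_color y = 24 + a"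
      unfolding 3 full_seam_color_simps a_def ..
    moreover have "0 \<le> a" "a < 5" by (simp_all add: a_def)
    ultimately have "24 \<le> full_seam_color y \<and> full_seam_color y \<le> 28"
      by simp
    moreover have "y mod 6 = 2" using 3 by simp
    ultimately show ?thesis by blast
  next
    case 4
    define a where "a = q mod 6"
    have "full_seam_color y = 30 + a"
      unfolding 4 full_seam_color_simps a_def ..
    moreover have "0 \<le> a" "a < 6" by (simp_all add: a_def)
    ultimately have "30 \<le> full_seam_color y \<and> full_seam_color y \<le> 35"
      by simp
    moreover have "y mod 6 = 3" using 4 by simp
    ultimately show ?thesis by blast
  next
    case 5
    define a where "a = q mod 7"
    have "full_seam_color y = (if a = 6 then 29 else 36 + a)"
      unfolding 5 full_seam_color_simps a_def ..
    moreover have "0 \<le> a" "a < 7" by (simp_all add: a_def)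
    ultimately have "full_seam_color y = 29 \<or>
        36 \<le> full_seam_color y \<and> full_seam_color y \<le> 41"
      by auto
    moreover have "y mod 6 = 4" using 5 by simp
    ultimately show ?thesis by blast
  next
    case 6
    define a where "a = q mod 9"
    have "full_seam_color y = (if a < 8 then 46 + a else if q mod 18 < 9 then 54 else 55)"
      unfolding 6 full_seam_color_simps a_def ..
    moreover have "0 \<le> a" "a < 9" by (simp_all add: a_def)
    ultimately have "46 \<le> full_seam_color y \<and> full_seam_color y \<le> 55"
      by auto
    moreover have "y mod 6 = 5" using 6 by simp
    ultimately show ?thesis by blast
  qed
qed

lemma full_seam_color_range: "18 \<le> full_seam_color y" "full_seam_color y \<le> 55"
  using full_seam_color_block[of y] by linarith+

lemma full_seam_color_separated:
  assumes eq: "full_seam_color y = full_seam_color y'"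
    and near: "\<bar>y - y'\<bar> \<le> full_seam_color y"
  shows "y = y'"
proof -
  define q r q' r' where "q = y div 6" and "r = y mod 6" and "q' = y' div 6" and "r' = y' mod 6"
  have y: "y = 6 * q + r" "y' = 6 * q' + r'"
    by (simp_all add: q_def r_def q'_def r'_def)
  note block = full_seam_color_block[of y, folded r_def] full_seam_color_block[of y', folded r'_def eq]
  have "r = r'"
    using block by linarith
  have close: "q = q'" if "q mod m = q' mod m" "full_seam_color y < 6 * m" for m
    using near that y \<open>r = r'\<close> by (intro eq_of_mod_eq[of q m]) auto
  have "0 \<le> r" "r < 6" by (simp_all add: r_def)
  then consider "r = 0" | "r = 1" | "r = 2" | "r = 3" | "r = 4" | "r = 5" by linarith
  then have "q = q'"
  proof cases
    case 1
    then have "18 + q mod 4 = 18 + q' mod 4"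
      using eq y \<open>r = r'\<close> by (simp add: full_seam_color_simps)
    moreover have "full_seam_color y < 24" using 1 block(1) by simp
    ultimately show ?thesis using close[of 4] by simp
  next
    case 2
    define a b a' b' where "a = q mod 4" and "b = q mod 8" and "a' = q' mod 4" and "b' = q' mod 8"
    have color: "full_seam_color y = (if a < 2 then 22 + a else 40 + a + (if b < 4 then 0 else 2))"
      "full_seam_color y = (if a' < 2 then 22 + a' else 40 + a' + (if b' < 4 then 0 else 2))"
      using full_seam_color_simps(2)[of q] full_seam_color_simps(2)[of q'] y 2 \<open>r = r'\<close>
      unfolding eq[symmetric] a_def b_def a'_def b'_def by (metis, metis eq)
    have a: "a < 4" "a' < 4" by (simp_all add: a_def a'_def)
    show ?thesis
    proof (cases "full_seam_color y < 24")
      case True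
      then have "a = a'" using color a by (simp split: if_splits)
      then show ?thesis using True close[of 4] by (simp add: a_def a'_def)
    next
      case False
      then have "a = a'" "b < 4 \<longleftrightarrow> b' < 4" using color a by (auto split: if_splits)
      then have "q mod 8 = q' mod 8"
        using eq_mod_double[of 4 q q'] by (simp add: a_def a'_def b_def b'_def)
      moreover have "full_seam_color y < 48" using 2 block(1) by auto
      ultimately show ?thesis using close[of 8] by simp
    qed
  next
    case 3
    then have "24 + q mod 5 = 24 + q' mod 5"
      using eq y \<open>r = r'\<close> by (simp add: full_seam_color_simps)
    moreover have "full_seam_color y < 30" using 3 block(1) by simp
    ultimately show ?thesis using close[of 5] by simp
  next
    case 4
    then have "30 + q mod 6 = 30 + q' mod 6"
      using eq y \<open>r = r'\<close> by (simp add: full_seam_color_simps)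
    moreover have "full_seam_color y < 36" using 4 block(1) by simp
    ultimately show ?thesis using close[of 6] by simp
  next
    case 5
    define a a' where "a = q mod 7" and "a' = q' mod 7"
    have color: "full_seam_color y = (if a = 6 then 29 else 36 + a)"
      "full_seam_color y = (if a' = 6 then 29 else 36 + a')"
      using full_seam_color_simps(5)[of q] full_seam_color_simps(5)[of q'] y 5 \<open>r = r'\<close>
      unfolding eq[symmetric] a_def a'_def by (metis, metis eq)
    have "0 \<le> a" "0 \<le> a'" by (simp_all add: a_def a'_def)
    then have "a = a'" using color by (simp split: if_splits)
    moreover have "full_seam_color y < 42" using 5 block(1) by auto
    ultimately show ?thesis using close[of 7] by (simp add: a_def a'_def)
  next
    case 6
    define a b a' b' where "a = q mod 9" and "b = q mod 18" and "a' = q' mod 9" and "b' = q' mod 18"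
    have color: "full_seam_color y = (if a < 8 then 46 + a else if b < 9 then 54 else 55)"
      "full_seam_color y = (if a' < 8 then 46 + a' else if b' < 9 then 54 else 55)"
      using full_seam_color_simps(6)[of q] full_seam_color_simps(6)[of q'] y 6 \<open>r = r'\<close>
      unfolding eq[symmetric] a_def b_def a'_def b'_def by (metis, metis eq)
    have a: "a < 9" "a' < 9" by (simp_all add: a_def a'_def)
    show ?thesis
    proof (cases "full_seam_color y < 54")
      case True
      then have "a = a'" using color a by (simp split: if_splits)
      then show ?thesis using True close[of 9] by (simp add: a_def a'_def)
    next
      case False
      then have "a = a'" "b < 9 \<longleftrightarrow> b' < 9" using color a by (auto split: if_splits)
      then have "q mod 18 = q' mod 18"
        using eq_mod_double[of 9 q q'] by (simp add: a_def a'_def b_def b'_def)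
      then show ?thesis using close[of 18] full_seam_color_range(2)[of y] by simp
    qed
  qed
  then show ?thesis using y \<open>r = r'\<close> by simp
qed


section \<open>Counting along a periodic sequence of steps\<close>

text \<open>
  The discrete antiderivative, vanishing at 0, of a function \<open>s\<close> of period \<open>t\<close>.
\<close>

definition cumulative :: "int \<Rightarrow> (int \<Rightarrow> int) \<Rightarrow> int \<Rightarrow> int" where
  "cumulative t s x = (x div t) * (\<Sum>i\<in>{0..<t}. s i) + (\<Sum>i\<in>{0..<x mod t}. s i)"

lemma cumulative_add_period:
  assumes "t \<noteq> 0"
  shows "cumulative t s (x + t) = cumulative t s x + (\<Sum>i\<in>{0..<t}. s i)"
  using assms by (simp add: cumulative_def algebra_simps)

lemma cumulative_step:
  assumes "0 < t" and "\<And>x. s (x mod t) = s x"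
  shows "cumulative t s (x + 1) = cumulative t s x + s x"
proof -
  define q r where "q = x div t" and "r = x mod t"
  have x: "x = q * t + r" and r: "0 \<le> r" "r < t"
    using assms(1) by (simp_all add: q_def r_def)
  have "{0..<r + 1} = insert r {0..<r}" using r by auto
  then have sum: "(\<Sum>i\<in>{0..<r + 1}. s i) = s x + (\<Sum>i\<in>{0..<r}. s i)"
    using assms(2)[of x] by (simp add: r_def)
  show ?thesis
  proof (cases "r + 1 = t")
    case True
    have "x + 1 = (q + 1) * t" using x True by (simp add: algebra_simps)
    then have "(x + 1) div t = q + 1" "(x + 1) mod t = 0"
      using assms(1) by simp_all
    then show ?thesis
      using sum True unfolding cumulative_def q_def[symmetric] r_def[symmetric]
      by (simp add: algebra_simps)
  next
    case False
    then have "r + 1 < t" using r by simp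
    moreover have "x + 1 = q * t + (r + 1)" using x by simp
    ultimately have "(x + 1) div t = q" "(x + 1) mod t = r + 1"
      using r by (metis add_nonneg_nonneg int_div_pos_eq mult.commute zero_le_one,
        metis add_nonneg_nonneg int_mod_pos_eq mult.commute zero_le_one)
    then show ?thesis
      using sum unfolding cumulative_def q_def[symmetric] r_def[symmetric] by simp
  qed
qed

text \<open>
  A step to the right changes \<open>(f, g)\<close> by at most one unit in the \<open>\<ell>\<^sub>1\<close>-norm, and it never moves \<open>f\<close>
  backwards, so the changes of \<open>f\<close> cannot cancel and the total displacement is bounded by the
  number of steps. Here \<open>f\<close> counts the columns of the original coloring and \<open>g\<close> sums up the slips: a
  seam spends its step on a slip instead of an advance.
\<close>

lemma steps_contract:
  fixes f g :: "int \<Rightarrow> int"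
  assumes step: "\<And>z. f z \<le> f (z + 1)" "\<And>z. f (z + 1) - f z + \<bar>g (z + 1) - g z\<bar> \<le> 1"
    and "x \<le> x'"
  shows "f x \<le> f x' \<and> f x' - f x + \<bar>g x' - g x\<bar> \<le> x' - x"
  using \<open>x \<le> x'\<close>
proof (induction x' rule: int_ge_induct)
  case base
  then show ?case by simp
next
  case (step z)
  then show ?case using assms(1,2)[of z] by linarith
qed


section \<open>The grid coloring cut open along seams\<close>

text \<open>
  On every stretch of \<open>t\<close> columns there are one full seam and \<open>h\<close> half seams. The first \<open>p\<close> half seams
  slip up and the others slip down, so that the slips add up to \<open>2 p - h\<close>. The two divisibility
  assumptions say that the coloring with these seams is invariant under \<open>(t, - k)\<close>.
\<close>

locale seamed_grid =
  fixes t k h p :: int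
  assumes t_ge: "923 \<le> t" and h: "0 \<le> h" "h \<le> 34" and p: "0 \<le> p" "p \<le> h"
    and width: "24 dvd t - (h + 1)" and twist: "24 dvd 2 * p - h - k"
begin

definition full_seam :: "int \<Rightarrow> bool" where
  "full_seam x \<longleftrightarrow> x mod t = 0"

definition half_seam :: "int \<Rightarrow> bool" where
  "half_seam x \<longleftrightarrow> x mod t \<in> (\<lambda>j. 49 + 25 * j) ` {0..<h}"

definition seam_index :: "int \<Rightarrow> int" where
  "seam_index x = (x mod t - 49) div 25"

definition advance :: "int \<Rightarrow> int" where
  "advance x = (if full_seam x \<or> half_seam x then 0 else 1)"

definition slip :: "int \<Rightarrow> int" where
  "slip x = (if half_seam x then if seam_index x < p then 1 else - 1 else 0)"

text \<open>
  Column \<open>x\<close> of the seamed grid, if it is not a seam, shows column \<open>column x\<close> of the original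
  coloring, shifted vertically by \<open>drift x\<close>.
\<close>

definition column :: "int \<Rightarrow> int" where
  "column = cumulative t advance"

definition drift :: "int \<Rightarrow> int" where
  "drift = cumulative t slip"

text \<open>
  The translation \<open>(t, - k)\<close> preserves the height \<open>y + x div t * k\<close> exactly but \<open>y + drift x\<close> only modulo
  24. The colors of the seams have periods that do not divide 24 and therefore refer to the former.
  On a half seam, the points that do not have color 1 have heights of the same parity, so halving
  the height numbers them consecutively.
\<close>

definition seamed_color :: "int \<Rightarrow> int \<Rightarrow> int" where
  "seamed_color x y =
     (if full_seam x then full_seam_color (y + x div t * k)
      else if half_seam x then
        (if odd (column x + (y + drift x)) then 1
         else half_seam_color (seam_index x) ((y + x div t * k) div 2))
      else grid_color (column x) (y + drift x))"

lemma half_seamE: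
  assumes "half_seam x"
  obtains "0 \<le> seam_index x" "seam_index x < h" "x = t * (x div t) + 49 + 25 * seam_index x"
proof -
  from assms obtain j where j: "0 \<le> j" "j < h" "x mod t = 49 + 25 * j"
    by (auto simp: half_seam_def)
  then have "seam_index x = j" by (simp add: seam_index_def)
  with j show thesis using that mult_div_mod_eq[of t x] by simp
qed

lemma column_step: "column (x + 1) = column x + advance x"
  unfolding column_def using t_ge
  by (intro cumulative_step) (auto simp: advance_def full_seam_def half_seam_def)

lemma drift_step: "drift (x + 1) = drift x + slip x"
  unfolding drift_def using t_ge
  by (intro cumulative_step) (auto simp: slip_def half_seam_def seam_index_def)

lemma sum_over_half_seams:
  "(\<Sum>x\<in>{0..<t}. if half_seam x then F (seam_index x) else 0) = (\<Sum>j\<in>{0..<h}. F j)"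
  for F :: "int \<Rightarrow> int"
proof -
  have "{x \<in> {0..<t}. half_seam x} = (\<lambda>j. 49 + 25 * j) ` {0..<h}"
    using t_ge h by (auto simp: half_seam_def)
  then have "(\<Sum>x\<in>{0..<t}. if half_seam x then F (seam_index x) else 0)
      = (\<Sum>x\<in>(\<lambda>j. 49 + 25 * j) ` {0..<h}. F (seam_index x))"
    by (simp add: sum.inter_filter[symmetric])
  also have "\<dots> = (\<Sum>j\<in>{0..<h}. F (seam_index (49 + 25 * j)))"
    by (subst sum.reindex) (auto simp: inj_on_def)
  also have "\<dots> = (\<Sum>j\<in>{0..<h}. F j)"
    using t_ge h by (intro sum.cong) (auto simp: seam_index_def)
  finally show ?thesis .
qed

lemma column_add_period: "column (x + t) = column x + (t - (h + 1))"
proof -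
  have "advance i = 1 - (if i = 0 then 1 else 0) - (if half_seam i then 1 else 0)"
    if "i \<in> {0..<t}" for i
    using that by (auto simp: advance_def full_seam_def half_seam_def)
  then have "(\<Sum>i\<in>{0..<t}. advance i)
      = (\<Sum>i\<in>{0..<t}. 1 - (if i = 0 then 1 else 0) - (if half_seam i then 1 else 0))"
    by (intro sum.cong) auto
  also have "\<dots> = t - 1 - h"
    using t_ge h sum_over_half_seams[of "\<lambda>_. 1"] by (simp add: sum_subtractf)
  finally show ?thesis
    using t_ge by (simp add: column_def cumulative_add_period)
qed

lemma drift_add_period: "drift (x + t) = drift x + (2 * p - h)"
proof -
  have "(\<Sum>i\<in>{0..<t}. slip i) = (\<Sum>j\<in>{0..<h}. if j < p then 1 else - 1)"
    unfolding slip_def by (rule sum_over_half_seams)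
  also have "\<dots> = (\<Sum>j\<in>{0..<p}. if j < p then 1 else - 1) + (\<Sum>j\<in>{p..<h}. if j < p then 1 else - 1)"
    using p by (subst sum.union_disjoint[symmetric]) (auto simp: ivl_disj_un)
  also have "\<dots> = 2 * p - h"
    using p by simp
  finally show ?thesis
    using t_ge by (simp add: drift_def cumulative_add_period)
qed

lemma seamed_color_periodic: "seamed_color (x + t) (y - k) = seamed_color x y"
proof -
  have same_column: "(x + t) mod t = x mod t" "(x + t) div t = x div t + 1"
    using t_ge by simp_all
  then have seams: "full_seam (x + t) = full_seam x" "half_seam (x + t) = half_seam x"
    "seam_index (x + t) = seam_index x"
    by (simp_all add: full_seam_def half_seam_def seam_index_def)
  have height: "y - k + (x + t) div t * k = y + x div t * k"
    using same_column by (simp add: algebra_simps)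
  have u: "column (x + t) mod 24 = column x mod 24"
    using width by (simp add: column_add_period mod_eq_dvd_iff)
  have "y - k + drift (x + t) = (y + drift x) + (2 * p - h - k)"
    by (simp add: drift_add_period)
  then have v: "(y - k + drift (x + t)) mod 24 = (y + drift x) mod 24"
    using twist by (simp add: mod_eq_dvd_iff)
  have parity: "even a \<longleftrightarrow> even b" if "a mod 24 = b mod 24" for a b :: int
    using that by (metis dvd_mod_iff even_numeral)
  have "even (column (x + t) + (y - k + drift (x + t))) = even (column x + (y + drift x))"
    using parity[OF u] parity[OF v] by simp
  then show ?thesis
    unfolding seamed_color_def seams height using grid_color_mod[OF u v] by simp
qed

lemma seamed_color_range: "1 \<le> seamed_color x y" "seamed_color x y \<le> 55"
  using full_seam_color_range half_seam_color_range grid_color_range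
  by (smt (verit) seamed_color_def)+

lemma step_bounds: "column x \<le> column (x + 1)"
  "column (x + 1) - column x + \<bar>drift (x + 1) - drift x\<bar> \<le> 1"
  by (auto simp: column_step drift_step advance_def slip_def)

text \<open>
  Removing the seams never increases distances, which is why the original coloring remains a packing
  coloring after their insertion.
\<close>

lemma grid_distance_le:
  "\<bar>column x' - column x\<bar> + \<bar>(y' + drift x') - (y + drift x)\<bar> \<le> \<bar>x' - x\<bar> + \<bar>y' - y\<bar>"
proof (cases "x \<le> x'")
  case True
  then show ?thesis
    using steps_contract[of column drift x x', OF step_bounds] by linarith
next
  case False
  then show ?thesis
    using steps_contract[of column drift x' x, OF step_bounds] by linarith
qed

text \<open>
  Contraction alone would allow two points to fall together in the original coloring. Points outside
  the seams do not, since each of their columns counts.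
\<close>

lemma column_strict:
  assumes "x < x'" and "\<not> full_seam x" "\<not> half_seam x"
  shows "column x < column x'"
proof -
  have "column x < column (x + 1)"
    using assms by (simp add: column_step advance_def)
  also have "\<dots> \<le> column x'"
    using steps_contract[of column drift "x + 1" x', OF step_bounds] assms(1) by linarith
  finally show ?thesis .
qed

text \<open>
  Points of color 1 have odd \<open>column x + (y + drift x)\<close>. This parity changes with every vertical step,
  and with every horizontal step too: an ordinary column advances by one, a half seam slips by one.
  Only the step out of a full seam leaves it unchanged, and full seams do not contain color 1.
\<close>

lemma color_1_separated:
  assumes "seamed_color x y = 1" "seamed_color x' y' = 1" and near: "\<bar>x' - x\<bar> + \<bar>y' - y\<bar> \<le> 1"
  shows "x' = x \<and> y' = y"
proof -
  have black: "odd (column a + (b + drift a)) \<and> \<not> full_seam a" if "seamed_color a b = 1" for a b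
    using that half_seam_color_range(1) full_seam_color_range(1) grid_color_eq_1_iff
    by (smt (verit) seamed_color_def)
  have flip: "odd (column (a + 1) + drift (a + 1)) \<longleftrightarrow> even (column a + drift a)"
    if "\<not> full_seam a" for a
    using that by (auto simp: column_step drift_step advance_def slip_def)
  note black_xy = black[OF assms(1)] black[OF assms(2)]
  consider "x' = x \<and> y' = y" | "x' = x" "y' = y + 1 \<or> y' = y - 1" | "x' = x + 1" "y' = y"
    | "x = x' + 1" "y' = y"
    using near by linarith
  then show ?thesis
  proof cases
    case 2
    then show ?thesis using black_xy by auto
  next
    case 3
    then show ?thesis using black_xy flip[of x] by auto
  next
    case 4
    then show ?thesis using black_xy flip[of x'] by auto
  qed simp
qed

text \<open>
  Going around the cylinder, the distance from the last half seam to the next full seam is at least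
  \<open>923 - (49 + 33 \<cdot> 25) = 49\<close>.
\<close>

lemma full_half_far:
  assumes "full_seam x" and "half_seam x'"
  shows "49 \<le> \<bar>x' - x\<bar>"
proof -
  obtain j where j: "0 \<le> j" "j < h" "x' = t * (x' div t) + 49 + 25 * j"
    using half_seamE[OF assms(2)] by metis
  have x: "x = t * (x div t)" using assms(1) by (auto simp: full_seam_def)
  define d where "d = x' div t - x div t"
  have diff: "x' - x = t * d + 49 + 25 * j" using x j(3) unfolding d_def by (simp add: algebra_simps)
  consider "0 \<le> d" | "d \<le> - 1" by linarith
  then show ?thesis
  proof cases
    case 1
    then have "0 \<le> t * d" using t_ge by simp
    then show ?thesis using diff j by linarith
  next
    case 2
    then have "t * d \<le> t * (- 1)" using t_ge by (intro mult_left_mono) auto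
    then show ?thesis using diff j h t_ge by linarith
  qed
qed

text \<open>
  The bound 47 is the largest color on half seams. Between the last half seam and the first one of the
  next turn there is a full seam, hence a gap of at least 98.
\<close>

lemma half_seams_near:
  assumes "half_seam x" "half_seam x'" and near: "\<bar>x' - x\<bar> \<le> 47"
  shows "x' = x \<or> \<bar>x' - x\<bar> = 25 \<and> even (seam_index x) \<noteq> even (seam_index x')"
proof -
  define j j' where "j = seam_index x" and "j' = seam_index x'"
  have j: "0 \<le> j" "j < h" "x = t * (x div t) + 49 + 25 * j"
    using half_seamE[OF assms(1)] unfolding j_def by metis+
  have j': "0 \<le> j'" "j' < h" "x' = t * (x' div t) + 49 + 25 * j'"
    using half_seamE[OF assms(2)] unfolding j'_def by metis+
  define d where "d = x' div t - x div t"
  have diff: "x' - x = t * d + 25 * (j' - j)"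
    using j(3) j'(3) unfolding d_def by (simp add: algebra_simps)
  have "d = 0"
  proof (rule ccontr)
    assume "d \<noteq> 0"
    then have "t * 1 \<le> t * \<bar>d\<bar>" using t_ge by (intro mult_left_mono) auto
    then have "t \<le> \<bar>t * d\<bar>" using t_ge by (simp add: abs_mult)
    moreover have "\<bar>25 * (j' - j)\<bar> \<le> 25 * 33" using j(1,2) j'(1,2) h by (simp add: abs_mult)
    ultimately show False using diff near t_ge by linarith
  qed
  with diff near have "j' = j \<or> j' = j + 1 \<or> j = j' + 1" "x' - x = 25 * (j' - j)" by auto
  then show ?thesis unfolding j_def[symmetric] j'_def[symmetric] by auto
qed

lemma seamed_color_separated:
  assumes eq: "seamed_color x y = seamed_color x' y'"
    and near: "\<bar>x' - x\<bar> + \<bar>y' - y\<bar> \<le> seamed_color x y"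
  shows "x' = x \<and> y' = y"
proof -
  define c where "c = seamed_color x y"
  have c: "seamed_color x y = c" "seamed_color x' y' = c" "\<bar>x' - x\<bar> + \<bar>y' - y\<bar> \<le> c"
    using eq near by (simp_all add: c_def)
  consider (one) "c = 1" | (grid) "1 < c" "c < 18" | (seam) "18 \<le> c"
    using seamed_color_range(1)[of x y] by (fold c_def) linarith
  then show ?thesis
  proof cases
    case one
    then show ?thesis using c by (intro color_1_separated) simp_all
  next
    case grid
    have plain: "\<not> full_seam a \<and> \<not> half_seam a \<and> grid_color (column a) (b + drift a) = c"
      if "seamed_color a b = c" for a b
      using that grid half_seam_color_range(1) full_seam_color_range(1)
      by (smt (verit) seamed_color_def)
    note xy = plain[OF c(1)] plain[OF c(2)]
    have "column x' = column x \<and> y' + drift x' = y + drift x"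
      using xy grid c(3) grid_distance_le[of x' x y' y] by (intro grid_color_separated) auto
    moreover from this have "x' = x"
      using xy column_strict[of x x'] column_strict[of x' x] by force
    ultimately show ?thesis by simp
  next
    case seam
    have on_seam: "full_seam a \<and> full_seam_color (b + a div t * k) = c \<or>
        half_seam a \<and> even (column a + (b + drift a)) \<and>
        half_seam_color (seam_index a) ((b + a div t * k) div 2) = c"
      if "seamed_color a b = c" for a b
      using that seam grid_color_range(2) by (smt (verit) seamed_color_def)
    consider (full) "full_seam x" "full_seam x'" "full_seam_color (y + x div t * k) = c"
        "full_seam_color (y' + x' div t * k) = c"
      | (mixed) "full_seam x \<and> half_seam x' \<or> full_seam x' \<and> half_seam x" "c \<le> 47"
      | (half) "half_seam x" "half_seam x'" "c \<le> 47"
        "even (column x + (y + drift x))" "even (column x' + (y' + drift x'))"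
        "half_seam_color (seam_index x) ((y + x div t * k) div 2) = c"
        "half_seam_color (seam_index x') ((y' + x' div t * k) div 2) = c"
      using on_seam[OF c(1)] on_seam[OF c(2)] half_seam_color_range(2) by metis
    then show ?thesis
    proof cases
      case full
      have "x' = x"
        using full(1,2) c(3) seamed_color_range(2)[of x y] t_ge
        by (intro eq_of_mod_eq[of x' t]) (auto simp: full_seam_def c_def)
      have "y' + x' div t * k = y + x div t * k"
      proof (rule full_seam_color_separated)
        show "full_seam_color (y' + x' div t * k) = full_seam_color (y + x div t * k)"
          using full(3,4) by simp
        show "\<bar>(y' + x' div t * k) - (y + x div t * k)\<bar> \<le> full_seam_color (y' + x' div t * k)"
          unfolding full(4) using c(3) \<open>x' = x\<close> by simp
      qed
      with \<open>x' = x\<close> show ?thesis by simp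
    next
      case mixed
      then have "49 \<le> \<bar>x' - x\<bar>"
        using full_half_far[of x x'] full_half_far[of x' x] by (auto simp: abs_minus_commute)
      then show ?thesis using mixed(2) c(3) by linarith
    next
      case half
      have "x' = x"
      proof (rule ccontr)
        assume "x' \<noteq> x"
        then have dist: "\<bar>x' - x\<bar> = 25" and parity: "even (seam_index x) \<noteq> even (seam_index x')"
          using half_seams_near[OF half(1,2)] half(3) c(3) by auto
        have "c < 24"
          using half_seam_colors_common[OF _ parity] half(6,7) by metis
        then show False using dist c(3) by linarith
      qed
      define Y Y' where "Y = y + x div t * k" and "Y' = y' + x' div t * k"
      have diff: "Y' - Y = y' - y" and parity: "even Y \<longleftrightarrow> even Y'"
        using half(4,5) \<open>x' = x\<close> by (auto simp: Y_def Y'_def)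
      from parity have two: "Y' - Y = 2 * (Y' div 2 - Y div 2)" by presburger
      have "Y' div 2 = Y div 2"
      proof (rule half_seam_color_separated)
        show "half_seam_color (seam_index x) (Y' div 2) = half_seam_color (seam_index x) (Y div 2)"
          using half(6,7) \<open>x' = x\<close> by (simp add: Y_def Y'_def)
        have "2 * \<bar>Y' div 2 - Y div 2\<bar> = \<bar>Y' - Y\<bar>"
          by (subst two) (simp only: abs_mult abs_numeral)
        also have "\<dots> \<le> c"
          using c(3) \<open>x' = x\<close> diff by simp
        also have "c = half_seam_color (seam_index x) (Y' div 2)"
          using half(7) \<open>x' = x\<close> by (simp add: Y'_def)
        finally show "2 * \<bar>Y' div 2 - Y div 2\<bar> \<le> half_seam_color (seam_index x) (Y' div 2)" .
      qed
      with two diff \<open>x' = x\<close> show ?thesis by simp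
    qed
  qed
qed

end


section \<open>The upper bound\<close>

theorem theorem4:
  fixes k t :: nat
  assumes "0 < k" and "k < t"
    and "even k" and "odd t" and "923 \<le> t"
    and "coprime k t"
  shows "packing_chromatic_number (distance_graph k t) \<le> 56"
proof -
  \<comment> \<open>The number of seams is \<open>h + 1\<close>, the representative of \<open>t\<close> modulo 24 between 13 and 36.\<close>
  define h where "h = 12 + (int t - 13) mod 24"
  \<comment> \<open>Solves \<open>2 p \<equiv> k + h\<close> modulo 24. The solution below 12 is admissible since \<open>h \<ge> 12\<close>.\<close>
  define p where "p = ((int k + h) div 2) mod 12"
  have "even h"
    using \<open>odd t\<close> unfolding h_def by presburger
  have h_range: "12 \<le> h" "h \<le> 34"
    using \<open>even h\<close> pos_mod_bound[of 24 "int t - 13"] unfolding h_def by presburger+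
  have "24 dvd int t - (h + 1)"
    unfolding h_def by presburger
  moreover have "24 dvd 2 * p - h - int k"
  proof -
    have "even (int k + h)" using \<open>even k\<close> \<open>even h\<close> by simp
    then show ?thesis unfolding p_def by presburger
  qed
  moreover have "0 \<le> p" "p < 12"
    by (simp_all add: p_def)
  ultimately interpret seamed_grid "int t" "int k" h p
    using \<open>923 \<le> t\<close> h_range by unfold_locales auto
  have "packing_chromatic_number (distance_graph k t) \<le> enat 56"
  proof (rule packing_chromatic_number_le_of_grid_coloring[of k t seamed_color])
    show "1 \<le> seamed_color x y \<and> seamed_color x y \<le> int 56" for x y
      using seamed_color_range[of x y] by simp
    show "seamed_color (x + int t) (y - int k) = seamed_color x y" for x y
      by (rule seamed_color_periodic)
    show "x' = x \<and> y' = y"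
      if "seamed_color x y = seamed_color x' y'" "\<bar>x' - x\<bar> + \<bar>y' - y\<bar> \<le> seamed_color x y"
      for x y x' y'
      using that by (rule seamed_color_separated)
  qed (use assms in simp_all)
  then show ?thesis by (simp add: numeral_eq_enat)
qed

end
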